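(* Let $1\le p<\infty$, let $K$ be a compact Hausdorff space, let $X,Y$ be Banach spaces, and let $m\leftrightarrow T:C(K,X)\to Y$ be a strongly bounded operator. If $T$ is limited completely continuous (respectively limited $p$-convergent), then for each $A\in\Sigma$ the operator $m(A):X\to Y$ is limited completely continuous (respectively limited $p$-convergent).
   Context: Operator means bounded linear map. $C(K,X)$ is the space of continuous functions $K\to X$ with the sup norm; $\Sigma$ is the Borel $\sigma$-algebra of $K$. Its dual is $rcabv(\Sigma,X^* )$, the regular countably additive $X^*$-valued Borel measures of bounded variation. Every operator $T:C(K,X)\to Y$ has a representing measure $m:\Sigma\to L(X,Y^{**})$ (written $m\leftrightarrow T$), $m(A)x=T^{**}(\chi_A x)$, where $\chi_A x\in C(K,X)^{**}$ acts on $\mu\in rcabv(\Sigma,X^* )$ by $\langle \mu(A),x\rangle$; one has $T(f)=\int_K f\,dm$. For $y^*\in Y^*$ put $y^*m=T^*(y^* )\in rcabv(\Sigma,X^* )$, so $\langle y^*m(A),x\rangle=\langle m(A)x,y^*\rangle$. The semivariation is $\tilde m(E)=\sup\{|y^*m|(E): \|y^*\|\le 1\}$, with $|\cdot|$ denoting variation. $T$ (or $m$) is strongly bounded if $\tilde m(A_i)\to 0$ for every decreasing sequence $(A_i)$ in $\Sigma$ with empty intersection; in that case $m$ takes values in $L(X,Y)$. A bounded subset $A$ of a Banach space $E$ is limited if $\sup_{x\in A}|x_n^*(x)|\to 0$ for every $w^*$-null sequence $(x_n^* )$ in $E^*$. A sequence $(x_n)$ in $E$ is weakly $p$-summable if $(x^*(x_n))\in\ell_p$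 for all $x^*\in E^*$. A limited weakly null (resp. limited weakly $p$-summable) sequence is a weakly null (resp. weakly $p$-summable) sequence whose set of terms is limited. An operator is limited completely continuous (resp. limited $p$-convergent) if it maps limited weakly null (resp. limited weakly $p$-summable) sequences to norm null sequences. *)

theory Defs
  imports "HOL-Analysis.Analysis"
begin

type_synonym 'a dual = "'a \<Rightarrow>\<^sub>L real"

definition canon :: "'a::real_normed_vector \<Rightarrow> 'a dual dual" where
  "canon x = Blinfun (\<lambda>\<phi>. blinfun_apply \<phi> x)"

lemma canon_apply [simp]: "blinfun_apply (canon x) \<phi> = blinfun_apply \<phi> x"
  by (simp add: canon_def bounded_linear_Blinfun_apply blinfun.bounded_linear_left)

definition dual_op ::
  "('a::real_normed_vector \<Rightarrow>\<^sub>L 'b::real_normed_vector) \<Rightarrow> 'b dual \<Rightarrow>\<^sub>L 'a dual" where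
  "dual_op T = Blinfun (\<lambda>\<phi>. \<phi> o\<^sub>L T)"

lemma dual_op_apply [simp]: "blinfun_apply (dual_op T) \<phi> = \<phi> o\<^sub>L T"
  by (simp add: dual_op_def bounded_linear_Blinfun_apply
      bounded_bilinear.bounded_linear_left[OF bounded_bilinear_blinfun_compose])


text \<open>
  Measures on the Borel sets of a topological space, with values in \<open>X\<^sup>*\<close>.
  Set functions are total; only their values on \<open>sets borel\<close> matter.
\<close>

definition variation ::
  "('k::topological_space set \<Rightarrow> 'b::real_normed_vector) \<Rightarrow> 'k set \<Rightarrow> ennreal" where
  "variation \<mu> E =
    (SUP P\<in>{P. finite P \<and> P \<subseteq> sets borel \<and> partition_on E P}. \<Sum>B\<in>P. ennreal (norm (\<mu> B)))"

text \<open>Regularity is that of the variation.\<close>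

definition rcabv :: "('k::topological_space set \<Rightarrow> ('x::real_normed_vector) dual) set" where
  "rcabv = {\<mu>.
     (\<forall>A::nat \<Rightarrow> 'k set. range A \<subseteq> sets borel \<longrightarrow> disjoint_family A \<longrightarrow>
        (\<lambda>n. \<mu> (A n)) sums \<mu> (\<Union>n. A n)) \<and>
     variation \<mu> UNIV < \<infinity> \<and>
     (\<forall>A\<in>sets borel. \<forall>\<epsilon>>0. \<exists>C U. compact C \<and> open U \<and> C \<subseteq> A \<and> A \<subseteq> U \<and>
        variation \<mu> (U - C) < ennreal \<epsilon>)}"

text \<open>
  The integral of an \<open>X\<close>-valued function against an \<open>X\<^sup>*\<close>-valued measure, for uniform limits of
  Borel simple functions. On a compact Hausdorff space every continuous function is such a limit,
  and for \<open>\<mu> \<in> rcabv\<close> the value does not depend on the approximating sequence.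
\<close>

definition simple_vint ::
  "('k::topological_space set \<Rightarrow> ('x::real_normed_vector) dual) \<Rightarrow> ('k \<Rightarrow> 'x) \<Rightarrow> real" where
  "simple_vint \<mu> s = (\<Sum>v\<in>range s. blinfun_apply (\<mu> (s -` {v})) v)"

definition has_vint ::
  "('k::topological_space set \<Rightarrow> ('x::real_normed_vector) dual) \<Rightarrow> ('k \<Rightarrow> 'x) \<Rightarrow> real \<Rightarrow> bool" where
  "has_vint \<mu> f I \<longleftrightarrow>
    (\<exists>s. (\<forall>n. simple_function borel (s n)) \<and> uniform_limit UNIV s f sequentially \<and>
         (\<lambda>n. simple_vint \<mu> (s n)) \<longlonglongrightarrow> I)"

text \<open>
  \<open>C(K, X)\<close> is the type \<open>'k \<Rightarrow>\<^sub>C 'x\<close> of bounded continuous functions, boundedness being automatic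
  when \<open>'k\<close> is compact. The next relation is the identification of its dual with \<open>rcabv\<close>.
\<close>

definition represents_functional ::
  "('k::topological_space set \<Rightarrow> ('x::real_normed_vector) dual) \<Rightarrow> ('k \<Rightarrow>\<^sub>C 'x) dual \<Rightarrow> bool" where
  "represents_functional \<mu> \<phi> \<longleftrightarrow>
    \<mu> \<in> rcabv \<and> (\<forall>f. has_vint \<mu> (apply_bcontfun f) (blinfun_apply \<phi> f))"

text \<open>
  \<open>is_chi A x \<Phi>\<close>: the element \<open>\<Phi>\<close> of \<open>C(K, X)\<^sup>*\<^sup>*\<close> is \<open>\<chi>\<^sub>A x\<close>, that is, its value at a functional
  is \<open>\<langle>\<mu>(A), x\<rangle>\<close> for the (unique) measure \<open>\<mu>\<close> representing that functional.
\<close>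

definition is_chi ::
  "'k::topological_space set \<Rightarrow> 'x::real_normed_vector \<Rightarrow> ('k \<Rightarrow>\<^sub>C 'x) dual dual \<Rightarrow> bool" where
  "is_chi A x \<Phi> \<longleftrightarrow>
    (\<forall>\<phi>. \<exists>\<mu>. represents_functional \<mu> \<phi> \<and> blinfun_apply \<Phi> \<phi> = blinfun_apply (\<mu> A) x)"

definition representing_measure ::
  "('k::topological_space set \<Rightarrow> 'x::real_normed_vector \<Rightarrow>\<^sub>L ('y::real_normed_vector) dual dual) \<Rightarrow>
   (('k \<Rightarrow>\<^sub>C 'x) \<Rightarrow>\<^sub>L 'y) \<Rightarrow> bool" where
  "representing_measure m T \<longleftrightarrow>
    (\<forall>A\<in>sets borel. \<forall>x. \<exists>\<Phi>. is_chi A x \<Phi> \<and>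
       blinfun_apply (m A) x = blinfun_apply (dual_op (dual_op T)) \<Phi>)"

text \<open>\<open>y\<^sup>*m\<close>, so that \<open>\<langle>y\<^sup>*m(A), x\<rangle> = \<langle>m(A)x, y\<^sup>*\<rangle>\<close>.\<close>

definition dual_measure ::
  "('y::real_normed_vector) dual \<Rightarrow>
   ('k set \<Rightarrow> 'x::real_normed_vector \<Rightarrow>\<^sub>L 'y dual dual) \<Rightarrow> 'k set \<Rightarrow> 'x dual" where
  "dual_measure \<psi> m A = canon \<psi> o\<^sub>L m A"

lemma dual_measure_apply:
  "blinfun_apply (dual_measure \<psi> m A) x = blinfun_apply (blinfun_apply (m A) x) \<psi>"
  by (simp add: dual_measure_def)

definition semivariation ::
  "('k::topological_space set \<Rightarrow> 'x::real_normed_vector \<Rightarrow>\<^sub>L ('y::real_normed_vector) dual dual) \<Rightarrow>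
   'k set \<Rightarrow> ennreal" where
  "semivariation m E = (SUP \<psi>\<in>{\<psi>. norm \<psi> \<le> 1}. variation (dual_measure \<psi> m) E)"

definition strongly_bounded ::
  "('k::topological_space set \<Rightarrow> 'x::real_normed_vector \<Rightarrow>\<^sub>L ('y::real_normed_vector) dual dual) \<Rightarrow>
   bool" where
  "strongly_bounded m \<longleftrightarrow>
    (\<forall>A::nat \<Rightarrow> 'k set. range A \<subseteq> sets borel \<longrightarrow> decseq A \<longrightarrow> (\<Inter>n. A n) = {} \<longrightarrow>
       (\<lambda>n. semivariation m (A n)) \<longlonglongrightarrow> 0)"


definition limited :: "'a::real_normed_vector set \<Rightarrow> bool" where
  "limited A \<longleftrightarrow> bounded A \<and>
    (\<forall>\<phi>::nat \<Rightarrow> 'a dual. (\<forall>x. (\<lambda>n. blinfun_apply (\<phi> n) x) \<longlonglongrightarrow> 0) \<longrightarrow>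
       (\<lambda>n. SUP x\<in>A. ennreal \<bar>blinfun_apply (\<phi> n) x\<bar>) \<longlonglongrightarrow> 0)"

definition weakly_null :: "(nat \<Rightarrow> 'a::real_normed_vector) \<Rightarrow> bool" where
  "weakly_null x \<longleftrightarrow> (\<forall>\<phi>::'a dual. (\<lambda>n. blinfun_apply \<phi> (x n)) \<longlonglongrightarrow> 0)"

definition weakly_p_summable :: "real \<Rightarrow> (nat \<Rightarrow> 'a::real_normed_vector) \<Rightarrow> bool" where
  "weakly_p_summable p x \<longleftrightarrow>
    (\<forall>\<phi>::'a dual. summable (\<lambda>n. \<bar>blinfun_apply \<phi> (x n)\<bar> powr p))"

definition limited_completely_continuous ::
  "('a::real_normed_vector \<Rightarrow>\<^sub>L 'b::real_normed_vector) \<Rightarrow> bool" where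
  "limited_completely_continuous T \<longleftrightarrow>
    (\<forall>x. weakly_null x \<and> limited (range x) \<longrightarrow> (\<lambda>n. blinfun_apply T (x n)) \<longlonglongrightarrow> 0)"

definition limited_p_convergent ::
  "real \<Rightarrow> ('a::real_normed_vector \<Rightarrow>\<^sub>L 'b::real_normed_vector) \<Rightarrow> bool" where
  "limited_p_convergent p T \<longleftrightarrow>
    (\<forall>x. weakly_p_summable p x \<and> limited (range x) \<longrightarrow> (\<lambda>n. blinfun_apply T (x n)) \<longlonglongrightarrow> 0)"

text \<open>\<open>S : X \<rightarrow> Y\<close> is \<open>R : X \<rightarrow> Y\<^sup>*\<^sup>*\<close> under the canonical embedding of \<open>Y\<close> in \<open>Y\<^sup>*\<^sup>*\<close>.\<close>

definition is_corestriction ::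
  "('x::real_normed_vector \<Rightarrow>\<^sub>L 'y::real_normed_vector) \<Rightarrow> ('x \<Rightarrow>\<^sub>L 'y dual dual) \<Rightarrow> bool" where
  "is_corestriction S R \<longleftrightarrow> (\<forall>x. canon (blinfun_apply S x) = blinfun_apply R x)"

end

theory Submission
  imports Defs
begin

text \<open>
  Strong boundedness and regularity give, for Borel \<open>A\<close> and \<open>\<epsilon> > 0\<close>, a compact \<open>C \<subseteq> A\<close> and an open
  \<open>U \<supseteq> A\<close> such that \<open>U - C\<close> has semivariation at most \<open>\<epsilon>\<close>. For a Urysohn function \<open>f\<close> that is \<open>1\<close> on \<open>C\<close>
  and \<open>0\<close> off \<open>U\<close>, the operator \<open>x \<mapsto> T (f x)\<close> is then within \<open>\<epsilon>\<close> of \<open>m(A)\<close>. Hence \<open>m(A)\<close> takes values in \<open>Y\<close>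
  and is a norm limit of operators \<open>T \<circ> J\<close> with \<open>J : X \<rightarrow> C(K, X)\<close> bounded. Both properties pass from \<open>T\<close>
  to \<open>T \<circ> J\<close>, since \<open>J\<close> preserves the sequences involved, and then to norm limits, since limited
  sequences are bounded.
\<close>

subsection \<open>A norming functional and the canonical embedding\<close>

definition sublinear :: "('a::real_vector \<Rightarrow> real) \<Rightarrow> bool" where
  "sublinear q \<longleftrightarrow> (\<forall>x y. q (x + y) \<le> q x + q y) \<and> (\<forall>t\<ge>0. \<forall>x. q (t *\<^sub>R x) = t * q x)"

lemma sublinear_add: "sublinear q \<Longrightarrow> q (x + y) \<le> q x + q y"
  and sublinear_scaleR: "sublinear q \<Longrightarrow> 0 \<le> t \<Longrightarrow> q (t *\<^sub>R x) = t * q x"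
  by (auto simp: sublinear_def)

lemma sublinear_zero: "sublinear q \<Longrightarrow> q 0 = 0"
  using sublinear_scaleR[of q 0 0] by simp

lemma sublinear_minus: "sublinear q \<Longrightarrow> - q (- x) \<le> q x"
  using sublinear_add[of q x "- x"] sublinear_zero[of q] by simp

text \<open>
  Hahn-Banach without partial extensions: tilting in direction \<open>z\<close> leaves a minimal sublinear
  functional unchanged, which makes it additive; tilting the norm in direction \<open>y\<close> first forces every
  linear functional below it to norm \<open>y\<close>.
\<close>

lemma sublinear_tilt:
  assumes q: "sublinear q"
  obtains r where "sublinear r" "r \<le> q" "\<And>x t. 0 \<le> t \<Longrightarrow> r x \<le> q (x + t *\<^sub>R z) - t * q z"
proof -
  define r where "r x = (INF t\<in>{0..}. q (x + t *\<^sub>R z) - t * q z)" for x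
  have low: "- q (- x) \<le> q (x + t *\<^sub>R z) - t * q z" if "0 \<le> t" for x t
    using sublinear_add[OF q, of "x + t *\<^sub>R z" "- x"] sublinear_scaleR[OF q that, of z] by simp
  have bdd: "bdd_below ((\<lambda>t. q (x + t *\<^sub>R z) - t * q z) ` {0..})" for x
    by (rule bdd_belowI[of _ "- q (- x)"]) (use low in auto)
  have upper: "r x \<le> q (x + t *\<^sub>R z) - t * q z" if "0 \<le> t" for x t
    unfolding r_def by (rule cINF_lower[OF bdd]) (use that in auto)
  have greatest: "b \<le> r x" if "\<And>t. 0 \<le> t \<Longrightarrow> b \<le> q (x + t *\<^sub>R z) - t * q z" for b x
    unfolding r_def by (rule cINF_greatest) (use that in auto)
  have add: "r (x + y) \<le> r x + r y" for x y
  proof -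
    \<comment> \<open>The two infima are taken in turn, over \<open>t\<close> with \<open>u\<close>
      fixed and then over \<open>u\<close>; the parameter \<open>t + u\<close> is admissible for
      \<open>x + y\<close>.\<close>
    have "r (x + y) - (q (y + u *\<^sub>R z) - u * q z) \<le> r x" if u: "0 \<le> u" for u
    proof (rule greatest)
      fix t :: real assume t: "0 \<le> t"
      have "r (x + y) \<le> q ((x + t *\<^sub>R z) + (y + u *\<^sub>R z)) - (t + u) * q z"
        using upper[of "t + u" "x + y"] t u by (simp add: algebra_simps)
      also have "\<dots> \<le> q (x + t *\<^sub>R z) + q (y + u *\<^sub>R z) - (t + u) * q z"
        using sublinear_add[OF q] by simp
      finally show "r (x + y) - (q (y + u *\<^sub>R z) - u * q z) \<le> q (x + t *\<^sub>R z) - t * q z"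
        by (simp add: algebra_simps)
    qed
    then have "r (x + y) - r x \<le> r y"
      by (intro greatest) (simp add: algebra_simps)
    then show ?thesis by simp
  qed
  have le: "r x \<le> q x" for x using upper[of 0 x] by simp
  have zero: "r 0 = 0"
    using le[of 0] sublinear_zero[OF q] add[of 0 0] by simp
  have scale_le: "r (s *\<^sub>R x) \<le> s * r x" if s: "0 < s" for s x
  proof -
    have "r (s *\<^sub>R x) / s \<le> r x"
    proof (rule greatest)
      fix t :: real assume t: "0 \<le> t"
      have "r (s *\<^sub>R x) \<le> q (s *\<^sub>R (x + t *\<^sub>R z)) - (s * t) * q z"
        using upper[of "s * t" "s *\<^sub>R x"] t s by (simp add: algebra_simps)
      also have "\<dots> = s * (q (x + t *\<^sub>R z) - t * q z)"
        using sublinear_scaleR[OF q, of s "x + t *\<^sub>R z"] s by (simp add: algebra_simps)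
      finally show "r (s *\<^sub>R x) / s \<le> q (x + t *\<^sub>R z) - t * q z"
        using s by (simp add: field_simps)
    qed
    then show ?thesis using s by (simp add: field_simps)
  qed
  have scale: "r (s *\<^sub>R x) = s * r x" if s: "0 \<le> s" for s x
  proof (cases "s = 0")
    case False
    then have "0 < s" using s by simp
    \<comment> \<open>The reverse inequality is the same bound for the factor
      \<open>inverse s\<close> at the point \<open>s *\<^sub>R x\<close>.\<close>
    then show ?thesis
      using scale_le[of s x] scale_le[of "inverse s" "s *\<^sub>R x"] by (simp add: field_simps)
  qed (simp add: zero)
  show thesis
    by (rule that[of r]) (use add scale le upper in \<open>auto simp: sublinear_def le_fun_def\<close>)
qed

text \<open>Subadditivity survives the infimum because, of any two members of a chain, the smaller
  one can be used at both points. The common lower bound \<open>b\<close> makes the real infima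
  meaningful.\<close>

lemma sublinear_Inf_chain:
  fixes C :: "('a::real_vector \<Rightarrow> real) set"
  assumes C: "\<And>q. q \<in> C \<Longrightarrow> sublinear q" and ne: "C \<noteq> {}"
    and chain: "\<And>q r. q \<in> C \<Longrightarrow> r \<in> C \<Longrightarrow> q \<le> r \<or> r \<le> q"
    and low: "\<And>q x. q \<in> C \<Longrightarrow> b x \<le> q x"
  shows "sublinear (\<lambda>x. INF q\<in>C. q x)"
proof -
  let ?r = "\<lambda>x. INF q\<in>C. q x"
  have bdd: "bdd_below ((\<lambda>q. q x) ` C)" for x
    by (rule bdd_belowI[of _ "b x"]) (use low in auto)
  have upper: "?r x \<le> q x" if "q \<in> C" for q x
    by (rule cINF_lower[OF bdd that])
  have "?r (x + y) \<le> ?r x + ?r y" for x y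
  proof -
    have *: "?r (x + y) \<le> q x + r y" if "q \<in> C" "r \<in> C" for q r
    proof (cases "q \<le> r")
      case True
      then have "q y \<le> r y" by (simp add: le_fun_def)
      then show ?thesis
        using upper[OF that(1), of "x + y"] sublinear_add[OF C[OF that(1)], of x y] by linarith
    next
      case False
      then have "r x \<le> q x" using chain[OF that] by (auto simp: le_fun_def)
      then show ?thesis
        using upper[OF that(2), of "x + y"] sublinear_add[OF C[OF that(2)], of x y] by linarith
    qed
    have "?r (x + y) - r y \<le> ?r x" if "r \<in> C" for r
      by (rule cINF_greatest[OF ne]) (use *[OF _ that] in \<open>simp add: algebra_simps\<close>)
    then have "?r (x + y) - ?r x \<le> ?r y"
      by (intro cINF_greatest[OF ne]) (simp add: algebra_simps)
    then show ?thesis by simp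
  qed
  moreover have "?r (t *\<^sub>R x) = t * ?r x" if "0 \<le> t" for t x
  proof -
    have "?r (t *\<^sub>R x) = (INF q\<in>C. t * q x)"
      by (intro INF_cong refl sublinear_scaleR C that)
    also have "\<dots> = t * ?r x"
    proof (rule antisym)
      have bdd': "bdd_below ((\<lambda>q. t * q x) ` C)"
        by (rule bdd_belowI[of _ "t * b x"]) (use low that in \<open>auto intro: mult_left_mono\<close>)
      show "t * ?r x \<le> (INF q\<in>C. t * q x)"
        using upper that by (intro cINF_greatest[OF ne]) (simp add: mult_left_mono)
      show "(INF q\<in>C. t * q x) \<le> t * ?r x"
      proof (cases "t = 0")
        case True
        then show ?thesis using ne by simp
      next
        case False
        then have t: "0 < t" using that by simp
        have "(INF q\<in>C. t * q x) / t \<le> ?r x"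
        proof (rule cINF_greatest[OF ne])
          fix q assume "q \<in> C"
          from cINF_lower[OF bdd' this] show "(INF q\<in>C. t * q x) / t \<le> q x"
            using t by (simp add: field_simps)
        qed
        then show ?thesis using t by (simp add: field_simps)
      qed
    qed
    finally show ?thesis .
  qed
  ultimately show ?thesis by (auto simp: sublinear_def)
qed

text \<open>The tilt in direction \<open>z\<close> must return \<open>q\<close> itself; its bound at
  \<open>t = 1\<close> then reads \<open>q x \<le> q (x + z) - q z\<close>, the missing
  superadditivity.\<close>

lemma minimal_sublinear_linear:
  assumes q: "sublinear q" and min: "\<And>r. sublinear r \<Longrightarrow> r \<le> q \<Longrightarrow> r = q"
  shows "linear q"
proof -
  have super: "q x + q z \<le> q (x + z)" for x z
  proof -
    obtain r where r: "sublinear r" "r \<le> q" "\<And>x t. 0 \<le> t \<Longrightarrow> r x \<le> q (x + t *\<^sub>R z) - t * q z"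
      using sublinear_tilt[OF q] by blast
    with min have "r = q" by blast
    then show ?thesis using r(3)[of 1 x] by simp
  qed
  have add: "q (x + z) = q x + q z" for x z
    using super sublinear_add[OF q] by (rule antisym[rotated])
  have neg: "q (- x) = - q x" for x
    using add[of x "- x"] sublinear_zero[OF q] by simp
  have "q (t *\<^sub>R x) = t * q x" for t x
  proof (cases "0 \<le> t")
    case False
    then show ?thesis
      using sublinear_scaleR[OF q, of "- t" x] neg[of "t *\<^sub>R x"] by simp
  qed (rule sublinear_scaleR[OF q])
  then show ?thesis using add by (intro linearI) auto
qed

lemma sublinear_dominates_linear:
  assumes p: "sublinear p"
  obtains q where "linear q" "q \<le> p"
proof -
  \<comment> \<open>Zorn is applied to the reversed pointwise order: a chain is bounded by its
    pointwise infimum, and a maximal element is a minimal sublinear functional below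
    \<open>p\<close>.\<close>
  let ?A = "{q. sublinear q \<and> q \<le> p}" and ?P = "\<lambda>a u. u \<le> (a :: 'a \<Rightarrow> real)"
  have "\<exists>q\<in>?A. \<forall>a\<in>?A. ?P q a \<longrightarrow> a = q"
  proof (rule predicate_Zorn)
    show "partial_order_on ?A (relation_of ?P ?A)"
      by (rule partial_order_on_relation_ofI) auto
  next
    fix C assume C: "C \<in> Chains (relation_of ?P ?A)"
    then have sub: "C \<subseteq> ?A" and tot: "\<And>q r. q \<in> C \<Longrightarrow> r \<in> C \<Longrightarrow> q \<le> r \<or> r \<le> q"
      by (auto simp: Chains_def relation_of_def)
    show "\<exists>u\<in>?A. \<forall>a\<in>C. ?P a u"
    proof (cases "C = {}")
      case True
      then show ?thesis using p by auto
    next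
      case False
      have low: "- p (- x) \<le> q x" if "q \<in> C" for q x
      proof -
        from sub that have "sublinear q" "q \<le> p" by auto
        then show ?thesis using sublinear_minus[of q x] le_funD[of q p "- x"] by linarith
      qed
      let ?r = "\<lambda>x. INF q\<in>C. q x"
      have "?r \<le> q" if "q \<in> C" for q
        using that low by (auto intro!: le_funI cINF_lower bdd_belowI2)
      moreover have "sublinear ?r"
        by (rule sublinear_Inf_chain[of _ "\<lambda>x. - p (- x)"]) (use sub False tot low in auto)
      ultimately show ?thesis
        using False sub by (intro bexI[of _ ?r]) (auto intro: order_trans)
    qed
  qed
  then obtain q where q: "sublinear q" "q \<le> p" "\<And>a. sublinear a \<Longrightarrow> a \<le> p \<Longrightarrow> a \<le> q \<Longrightarrow> a = q"
    by auto
  then have "linear q"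
    by (intro minimal_sublinear_linear) (auto intro: order_trans)
  then show thesis using that q(2) by blast
qed

lemma norming_functional:
  fixes y :: "'a::real_normed_vector"
  obtains \<phi> :: "'a dual" where "norm \<phi> \<le> 1" "blinfun_apply \<phi> y = norm y"
proof -
  have "sublinear (norm :: 'a \<Rightarrow> real)"
    by (auto simp: sublinear_def norm_triangle_ineq)
  then obtain r where r: "sublinear r" "r \<le> norm"
      "\<And>x t. 0 \<le> t \<Longrightarrow> r x \<le> norm (x + t *\<^sub>R y) - t * norm y"
    using sublinear_tilt[of "norm :: 'a \<Rightarrow> real" y] by blast
  obtain q where q: "linear q" "q \<le> r"
    using sublinear_dominates_linear[OF r(1)] .
  have le: "q x \<le> norm x" for x
    using q(2) r(2) by (meson le_funD order_trans)
  have abs_le: "\<bar>q x\<bar> \<le> norm x" for x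
    using le[of x] le[of "- x"] linear_neg[OF q(1), of x] by simp
  then have bl: "bounded_linear q"
    by (intro bounded_linear_intro[of q 1]) (use q(1) in \<open>auto simp: linear_add linear_scale\<close>)
  \<comment> \<open>At \<open>x = - y\<close> and \<open>t = 1\<close> the tilt bound is
    \<open>norm 0 - norm y\<close>.\<close>
  have "q (- y) \<le> - norm y"
    using le_funD[OF q(2), of "- y"] r(3)[of 1 "- y"] by simp
  then have "q y = norm y"
    using le[of y] linear_neg[OF q(1), of y] by simp
  moreover have "norm (Blinfun q) \<le> 1"
    by (rule norm_blinfun_bound) (use abs_le in \<open>auto simp: bounded_linear_Blinfun_apply[OF bl]\<close>)
  ultimately show thesis
    by (intro that[of "Blinfun q"]) (auto simp: bounded_linear_Blinfun_apply[OF bl])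
qed

text \<open>A norming functional makes the embedding isometric, so that estimates in the bidual can
  be read back in the space itself.\<close>

lemma norm_canon [simp]: "norm (canon y) = norm y"
proof (rule antisym)
  show "norm (canon y) \<le> norm y"
  proof (rule norm_blinfun_bound)
    show "norm (blinfun_apply (canon y) \<phi>) \<le> norm y * norm \<phi>" for \<phi>
      using norm_blinfun[of \<phi> y] by (simp add: mult.commute)
  qed simp
  obtain \<phi> :: "'a dual" where \<phi>: "norm \<phi> \<le> 1" "blinfun_apply \<phi> y = norm y"
    by (rule norming_functional)
  have "norm y \<le> norm (canon y) * norm \<phi>"
    using norm_blinfun[of "canon y" \<phi>] \<phi>(2) by simp
  also have "\<dots> \<le> norm (canon y)"
    using \<phi>(1) by (simp add: mult_left_le)
  finally show "norm y \<le> norm (canon y)" .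
qed

lemma canon_diff: "canon (x - y) = canon x - canon y"
  by (rule blinfun_eqI) (simp add: blinfun.diff_left blinfun.diff_right)


subsection \<open>Variation of finitely additive measures\<close>

text \<open>Isolates what the variation lemmas use of a member of \<open>rcabv\<close>; additivity
  is asked on Borel sets only because values elsewhere are arbitrary.\<close>

definition finitely_additive :: "('k::topological_space set \<Rightarrow> 'b::real_normed_vector) \<Rightarrow> bool" where
  "finitely_additive \<mu> \<longleftrightarrow> \<mu> {} = 0 \<and>
    (\<forall>A\<in>sets borel. \<forall>B\<in>sets borel. A \<inter> B = {} \<longrightarrow> \<mu> (A \<union> B) = \<mu> A + \<mu> B)"

lemma finitely_additive_empty: "finitely_additive \<mu> \<Longrightarrow> \<mu> {} = 0"
  and finitely_additive_Un: "finitely_additive \<mu> \<Longrightarrow> A \<in> sets borel \<Longrightarrow> B \<in> sets borel \<Longrightarrow>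
    A \<inter> B = {} \<Longrightarrow> \<mu> (A \<union> B) = \<mu> A + \<mu> B"
  by (auto simp: finitely_additive_def)

lemma finitely_additive_UN:
  assumes \<mu>: "finitely_additive \<mu>" and "finite I"
    and "\<And>i. i \<in> I \<Longrightarrow> A i \<in> sets borel" and "disjoint_family_on A I"
  shows "\<mu> (\<Union>i\<in>I. A i) = (\<Sum>i\<in>I. \<mu> (A i))"
  using \<open>finite I\<close> assms(3,4)
proof (induction I)
  case (insert i I)
  have dis: "A i \<inter> (\<Union>j\<in>I. A j) = {}" "disjoint_family_on A I"
    using insert.hyps insert.prems(2) by (auto simp: disjoint_family_on_def)
  have meas: "(\<Union>j\<in>I. A j) \<in> sets borel" "A i \<in> sets borel"
    using insert.hyps insert.prems(1) by auto
  have "\<mu> (\<Union>j\<in>insert i I. A j) = \<mu> (A i) + \<mu> (\<Union>j\<in>I. A j)"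
    using finitely_additive_Un[OF \<mu> meas(2,1) dis(1)] by simp
  also have "\<mu> (\<Union>j\<in>I. A j) = (\<Sum>j\<in>I. \<mu> (A j))"
    using insert.prems(1) dis(2) by (intro insert.IH) auto
  finally show ?case
    using insert.hyps by simp
qed (simp add: finitely_additive_empty[OF \<mu>])

text \<open>A series with constant term \<open>\<mu> {}\<close> converges only if that term is zero;
  padding two disjoint sets with empty sets then turns countable into finite additivity.\<close>

lemma rcabv_finitely_additive:
  assumes "\<mu> \<in> rcabv"
  shows "finitely_additive \<mu>"
proof -
  have sums: "(\<lambda>n. \<mu> (A n)) sums \<mu> (\<Union>n. A n)"
    if "range A \<subseteq> sets borel" "disjoint_family A" for A :: "nat \<Rightarrow> _"
    using assms that by (simp add: rcabv_def)
  have "(\<lambda>n::nat. \<mu> {}) sums \<mu> {}"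
    using sums[of "\<lambda>_. {}"] by (simp add: disjoint_family_on_def)
  then have empty: "\<mu> {} = 0"
    using sums_summable summable_LIMSEQ_zero tendsto_const_iff trivial_limit_sequentially by blast
  have "\<mu> (A \<union> B) = \<mu> A + \<mu> B" if "A \<in> sets borel" "B \<in> sets borel" "A \<inter> B = {}" for A B
  proof -
    have "(\<lambda>n. \<mu> (binaryset A B n)) sums \<mu> (\<Union>n. binaryset A B n)"
    proof (rule sums)
      show "range (binaryset A B) \<subseteq> sets borel"
        using that by (auto simp: range_binaryset_eq)
      show "disjoint_family (binaryset A B)"
        using that by (auto simp: disjoint_family_on_def binaryset_def)
    qed
    then show ?thesis
      using binaryset_sums[of \<mu> A B] empty sums_unique2 by (metis UN_binaryset_eq)
  qed
  with empty show ?thesis by (simp add: finitely_additive_def)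
qed

text \<open>Partitions in the sense of \<open>partition_on\<close> cover \<open>E\<close> and have
  no empty block, so a disjoint family is completed by its remainder in \<open>E\<close> and
  stripped of empty members before it enters the supremum.\<close>

lemma sum_norm_le_variation:
  assumes \<mu>: "finitely_additive \<mu>" and E: "E \<in> sets borel" and fin: "finite I"
    and A: "\<And>i. i \<in> I \<Longrightarrow> A i \<in> sets borel" "\<And>i. i \<in> I \<Longrightarrow> A i \<subseteq> E" and dis: "disjoint_family_on A I"
  shows "(\<Sum>i\<in>I. ennreal (norm (\<mu> (A i)))) \<le> variation \<mu> E"
proof -
  define J where "J = {i\<in>I. A i \<noteq> {}}"
  define R where "R = E - (\<Union>i\<in>I. A i)"
  define P where "P = A ` J \<union> ({R} - {{}})"
  \<comment> \<open>A disjoint family can repeat only the empty set, so on \<open>J\<close> the sum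
    over indices is a sum over blocks.\<close>
  have inj: "inj_on A J"
    using dis unfolding J_def inj_on_def disjoint_family_on_def by blast
  have "partition_on E P"
  proof (rule partition_onI)
    have "\<Union>P = (\<Union>i\<in>I. A i) \<union> R"
      by (auto simp: P_def J_def)
    moreover have "(\<Union>i\<in>I. A i) \<subseteq> E"
      using A(2) by (rule UN_least)
    ultimately show "\<Union>P = E"
      by (auto simp: R_def)
    show "disjnt p q" if "p \<in> P" "q \<in> P" "p \<noteq> q" for p q
    proof -
      have *: "disjnt (A i) R" if "i \<in> I" for i
        using that unfolding R_def disjnt_def by blast
      have "disjnt (A i) (A j)" if "i \<in> I" "j \<in> I" "A i \<noteq> A j" for i j
      proof -
        have "i \<noteq> j" using that(3) by auto
        then show ?thesis
          using disjoint_family_onD[OF dis that(1,2)] by (simp add: disjnt_def)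
      qed
      moreover have "p \<in> A ` I \<or> p = R" "q \<in> A ` I \<or> q = R"
        using \<open>p \<in> P\<close> \<open>q \<in> P\<close> by (auto simp: P_def J_def)
      ultimately show ?thesis
        using * \<open>p \<noteq> q\<close> by (metis disjnt_sym imageE)
    qed
  qed (auto simp: P_def J_def)
  moreover have "R \<in> sets borel"
    unfolding R_def using fin A(1) E by (intro sets.Diff sets.finite_UN) auto
  then have "finite P" "P \<subseteq> sets borel"
    using fin A(1) by (auto simp: P_def J_def)
  ultimately have le: "(\<Sum>B\<in>P. ennreal (norm (\<mu> B))) \<le> variation \<mu> E"
    unfolding variation_def by (intro SUP_upper) auto
  have "(\<Sum>i\<in>I. ennreal (norm (\<mu> (A i)))) = (\<Sum>i\<in>J. ennreal (norm (\<mu> (A i))))"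
    by (rule sum.mono_neutral_right) (use fin finitely_additive_empty[OF \<mu>] in \<open>auto simp: J_def\<close>)
  also have "\<dots> = (\<Sum>B\<in>A ` J. ennreal (norm (\<mu> B)))"
    by (simp add: sum.reindex[OF inj])
  also have "\<dots> \<le> (\<Sum>B\<in>P. ennreal (norm (\<mu> B)))"
    by (rule sum_mono2) (use \<open>finite P\<close> in \<open>auto simp: P_def\<close>)
  finally show ?thesis using le by simp
qed

lemma variation_least:
  assumes "\<And>P. finite P \<Longrightarrow> P \<subseteq> sets borel \<Longrightarrow> partition_on E P \<Longrightarrow>
    (\<Sum>B\<in>P. ennreal (norm (\<mu> B))) \<le> c"
  shows "variation \<mu> E \<le> c"
  unfolding variation_def by (rule SUP_least) (use assms in auto)

lemma variation_mono:
  assumes "finitely_additive \<mu>" and "E \<subseteq> F" and "F \<in> sets borel"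
  shows "variation \<mu> E \<le> variation \<mu> F"
proof (rule variation_least)
  fix P assume "finite P" "P \<subseteq> sets borel" "partition_on E P"
  then show "(\<Sum>B\<in>P. ennreal (norm (\<mu> B))) \<le> variation \<mu> F"
    using sum_norm_le_variation[OF assms(1,3), of P "\<lambda>B. B"] assms(2)
    by (auto simp: partition_on_def disjoint_family_on_def pairwise_def disjnt_def)
qed

text \<open>Every block of a partition of \<open>E\<close> is cut by \<open>D\<close> into two
  parts, and the parts form disjoint families inside the two pieces.\<close>

lemma variation_subadditive:
  assumes \<mu>: "finitely_additive \<mu>" and E: "E \<in> sets borel" and D: "D \<in> sets borel"
  shows "variation \<mu> E \<le> variation \<mu> (E - D) + variation \<mu> (E \<inter> D)"
proof (rule variation_least)
  fix P assume P: "finite P" "P \<subseteq> sets borel" "partition_on E P"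
  have part: "(\<Sum>B\<in>P. ennreal (norm (\<mu> (B \<inter> G)))) \<le> variation \<mu> (E \<inter> G)" if "G \<in> sets borel" for G
    using P E that
    by (intro sum_norm_le_variation[OF \<mu>])
      (auto simp: partition_on_def disjoint_family_on_def pairwise_def disjnt_def)
  have "(\<Sum>B\<in>P. ennreal (norm (\<mu> B))) \<le>
      (\<Sum>B\<in>P. ennreal (norm (\<mu> (B \<inter> - D))) + ennreal (norm (\<mu> (B \<inter> D))))"
  proof (rule sum_mono)
    fix B assume "B \<in> P"
    then have "B \<in> sets borel" using P by blast
    then have "\<mu> ((B \<inter> - D) \<union> (B \<inter> D)) = \<mu> (B \<inter> - D) + \<mu> (B \<inter> D)"
      using D by (intro finitely_additive_Un[OF \<mu>]) auto
    also have "(B \<inter> - D) \<union> (B \<inter> D) = B" by blast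
    finally show "ennreal (norm (\<mu> B)) \<le> ennreal (norm (\<mu> (B \<inter> - D))) + ennreal (norm (\<mu> (B \<inter> D)))"
      by (simp add: norm_triangle_ineq flip: ennreal_plus)
  qed
  also have "\<dots> \<le> variation \<mu> (E \<inter> - D) + variation \<mu> (E \<inter> D)"
    unfolding sum.distrib using part[of D] part[of "- D"] D by (intro add_mono) auto
  finally show "(\<Sum>B\<in>P. ennreal (norm (\<mu> B))) \<le> variation \<mu> (E - D) + variation \<mu> (E \<inter> D)"
    by (simp add: Diff_eq)
qed

text \<open>Later \<open>dual_measure \<psi> m\<close> is identified with a regular measure on Borel
  sets only; this is enough to exchange the variations.\<close>

lemma variation_cong:
  assumes "\<And>A. A \<in> sets borel \<Longrightarrow> \<mu> A = \<nu> A"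
  shows "variation \<mu> E = variation \<nu> E"
  unfolding variation_def using assms by (intro SUP_cong sum.cong) auto

text \<open>The shift \<open>k\<close> serves an index that is collected at stage \<open>k\<close>
  and is controlled only from then on.\<close>

lemma variation_Inter_null:
  assumes \<mu>: "finitely_additive \<mu>" and D: "\<And>n. D n \<in> sets borel"
    and lim: "\<And>n. variation \<mu> (D (n + k)) \<le> ennreal (1 / Suc n)"
  shows "variation \<mu> (\<Inter>n. D n) = 0"
proof -
  have "variation \<mu> (\<Inter>n. D n) \<le> ennreal (1 / Suc n)" for n
    using variation_mono[OF \<mu>, of "\<Inter>n. D n" "D (n + k)"] D lim[of n]
    by (auto intro: order_trans)
  moreover have "(\<lambda>n. ennreal (1 / Suc n)) \<longlonglongrightarrow> ennreal 0"
    using LIMSEQ_inverse_real_of_nat by (intro tendsto_ennrealI) (simp add: inverse_eq_divide)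
  ultimately have "variation \<mu> (\<Inter>n. D n) \<le> ennreal 0"
    by (intro LIMSEQ_le_const) auto
  then show ?thesis by simp
qed

text \<open>
  This replaces the control measure: indices that violate the bound are collected greedily, each being made
  small on all later sets, so that the intersection is null for every chosen index and removing it
  leaves a sequence decreasing to the empty set on which the variations stay large.
\<close>

lemma uniformly_small_variation:
  fixes \<nu> :: "'i \<Rightarrow> 'k::topological_space set \<Rightarrow> 'b::real_normed_vector"
  assumes add: "\<And>i. i \<in> I \<Longrightarrow> finitely_additive (\<nu> i)"
    and \<D>: "\<D> \<subseteq> sets borel" "\<D> \<noteq> {}" "\<And>D E. D \<in> \<D> \<Longrightarrow> E \<in> \<D> \<Longrightarrow> D \<inter> E \<in> \<D>"
    and small: "\<And>i d. i \<in> I \<Longrightarrow> 0 < d \<Longrightarrow> \<exists>D\<in>\<D>. variation (\<nu> i) D < ennreal d"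
    and cont: "\<And>A::nat \<Rightarrow> _. range A \<subseteq> sets borel \<Longrightarrow> decseq A \<Longrightarrow> (\<Inter>n. A n) = {} \<Longrightarrow>
      (\<lambda>n. SUP i\<in>I. variation (\<nu> i) (A n)) \<longlonglongrightarrow> 0"
    and "0 < e"
  shows "\<exists>D\<in>\<D>. \<forall>i\<in>I. variation (\<nu> i) D \<le> ennreal e"
proof (rule ccontr)
  assume "\<not> ?thesis"
  then have bad: "\<exists>i\<in>I. ennreal e < variation (\<nu> i) D" if "D \<in> \<D>" for D
    using that by (meson not_le)
  \<comment> \<open>Each index has its own small set; intersecting finitely many of these stays in
    \<open>\<D>\<close> and, by monotonicity, keeps all the bounds.\<close>
  have refine: "\<exists>E\<in>\<D>. E \<subseteq> D \<and> (\<forall>i\<in>F. variation (\<nu> i) E \<le> ennreal d)"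
    if "finite F" "F \<subseteq> I" "D \<in> \<D>" "0 < d" for F D d
    using that(1,2)
  proof (induction F)
    case empty
    then show ?case using that by auto
  next
    case (insert i F)
    then obtain E where E: "E \<in> \<D>" "E \<subseteq> D" "\<And>j. j \<in> F \<Longrightarrow> variation (\<nu> j) E \<le> ennreal d"
      by auto
    obtain G where G: "G \<in> \<D>" "variation (\<nu> i) G < ennreal d"
      using small[of i d] insert \<open>0 < d\<close> by auto
    have mono: "variation (\<nu> j) (E \<inter> G) \<le> variation (\<nu> j) E"
        "variation (\<nu> j) (E \<inter> G) \<le> variation (\<nu> j) G" if "j \<in> I" for j
      using E(1) G(1) \<D>(1) by (auto intro!: variation_mono add[OF that])
    show ?case
    proof (intro bexI[of _ "E \<inter> G"] conjI ballI)
      show "E \<inter> G \<in> \<D>" "E \<inter> G \<subseteq> D"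
        using E G \<D>(3) by auto
      fix j assume "j \<in> insert i F"
      then show "variation (\<nu> j) (E \<inter> G) \<le> ennreal d"
        using E(3) G(2) mono[of j] insert.prems by (metis insertE insert_subset less_imp_le order_trans subsetD)
    qed
  qed
  \<comment> \<open>A state consists of the collected indices and the current set. \<open>?P\<close>
    keeps these indices small on that set; \<open>?Q\<close> says that the next state has collected
    an index violating the bound on it.\<close>
  let ?P = "\<lambda>n (F, D). finite F \<and> F \<subseteq> I \<and> D \<in> \<D> \<and> (\<forall>i\<in>F. variation (\<nu> i) D \<le> ennreal (1 / Suc n))"
  let ?Q = "\<lambda>n (F, D) (F', D'). F \<subseteq> F' \<and> D' \<subseteq> D \<and> (\<exists>i\<in>F'. ennreal e < variation (\<nu> i) D)"
  have "\<exists>s. \<forall>n. ?P n (s n) \<and> ?Q n (s n) (s (Suc n))"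
  proof (rule dependent_nat_choice)
    show "\<exists>s. ?P 0 s" using \<D>(2) by auto
    fix s n assume "?P n s"
    then obtain F D where s: "s = (F, D)" "finite F" "F \<subseteq> I" "D \<in> \<D>" by auto
    obtain i where i: "i \<in> I" "ennreal e < variation (\<nu> i) D"
      using bad[OF s(4)] by auto
    obtain E where "E \<in> \<D>" "E \<subseteq> D" "\<forall>j\<in>insert i F. variation (\<nu> j) E \<le> ennreal (1 / Suc (Suc n))"
      using refine[of "insert i F" D "1 / Suc (Suc n)"] s i by auto
    with s i show "\<exists>s'. ?P (Suc n) s' \<and> ?Q n s s'"
      by (intro exI[of _ "(insert i F, E)"]) auto
  qed
  then obtain s where s: "\<forall>n. ?P n (s n) \<and> ?Q n (s n) (s (Suc n))" ..
  define F D where "F n = fst (s n)" and "D n = snd (s n)" for n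
  have F: "F n \<subseteq> I" "F n \<subseteq> F (Suc n)" and D: "D n \<in> \<D>" "D (Suc n) \<subseteq> D n"
    and FD: "\<And>i. i \<in> F n \<Longrightarrow> variation (\<nu> i) (D n) \<le> ennreal (1 / Suc n)"
    and ex: "\<exists>i\<in>F (Suc n). ennreal e < variation (\<nu> i) (D n)" for n
    using spec[OF s, of n] by (simp_all add: F_def D_def split_beta)
  have D_borel: "D n \<in> sets borel" for n
    using D(1) \<D>(1) by blast
  have F_mono: "F n \<subseteq> F (n + k)" for n k
    by (induction k) (use F(2) in auto)
  let ?N = "\<Inter>n. D n"
  have N_borel: "?N \<in> sets borel" using D_borel by auto
  have null: "variation (\<nu> i) ?N = 0" if i: "i \<in> F k" for i k
  proof (rule variation_Inter_null)
    show "finitely_additive (\<nu> i)" using add F(1) i by blast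
    fix n
    have "variation (\<nu> i) (D (n + k)) \<le> ennreal (1 / Suc (n + k))"
      using FD[of i "n + k"] F_mono[of k n] i by (auto simp: add.commute)
    also have "\<dots> \<le> ennreal (1 / Suc n)"
      by (intro ennreal_leI divide_left_mono) auto
    finally show "variation (\<nu> i) (D (n + k)) \<le> ennreal (1 / Suc n)" .
  qed (rule D_borel)
  \<comment> \<open>The violating index is large on \<open>D n\<close> but null on
    \<open>?N\<close>, so removing \<open>?N\<close> costs nothing, while the sets
    \<open>D n - ?N\<close> decrease to the empty set.\<close>
  have "ennreal e \<le> (SUP i\<in>I. variation (\<nu> i) (D n - ?N))" for n
  proof -
    obtain i where i: "i \<in> F (Suc n)" "ennreal e < variation (\<nu> i) (D n)" using ex by blast
    then have "i \<in> I" using F(1) by blast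
    have "variation (\<nu> i) (D n) \<le> variation (\<nu> i) (D n - ?N) + variation (\<nu> i) (D n \<inter> ?N)"
      by (rule variation_subadditive[OF add[OF \<open>i \<in> I\<close>] D_borel N_borel])
    also have "D n \<inter> ?N = ?N" by blast
    finally have "ennreal e \<le> variation (\<nu> i) (D n - ?N)"
      using i null[OF i(1)] by simp
    also have "\<dots> \<le> (SUP i\<in>I. variation (\<nu> i) (D n - ?N))"
      using \<open>i \<in> I\<close> by (rule SUP_upper)
    finally show ?thesis .
  qed
  moreover have "(\<lambda>n. SUP i\<in>I. variation (\<nu> i) (D n - ?N)) \<longlonglongrightarrow> 0"
  proof (rule cont)
    show "range (\<lambda>n. D n - ?N) \<subseteq> sets borel" using D_borel N_borel by auto
    show "decseq (\<lambda>n. D n - ?N)" using D(2) by (intro decseq_SucI) blast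
  qed auto
  ultimately have "ennreal e \<le> 0" by (intro LIMSEQ_le_const) auto
  with \<open>0 < e\<close> show False by simp
qed

section \<open>Integrals of simple functions and their error bounds\<close>

lemma simple_function_borel_partition:
  assumes "simple_function borel g"
  shows "finite (range g)" "g -` {c} \<in> sets borel" "disjoint_family_on (\<lambda>c. g -` {c}) C"
proof -
  show "finite (range g)" using assms by (simp add: simple_function_def)
  show "g -` {c} \<in> sets borel"
  proof (cases "c \<in> range g")
    case True
    then show ?thesis using assms by (auto simp: simple_function_def)
  next
    case False
    then have "g -` {c} = {}" by blast
    then show ?thesis by simp
  qed
qed (auto simp: disjoint_family_on_def)

text \<open>Each level set of the integrand is a finite union of level sets of \<open>g\<close>, so
  additivity permits computing the integral on the finer partition.\<close>

lemma simple_vint_comp: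
  assumes \<mu>: "finitely_additive \<mu>" and g: "simple_function borel g"
  shows "simple_vint \<mu> (\<lambda>t. h (g t)) = (\<Sum>c\<in>range g. blinfun_apply (\<mu> (g -` {c})) (h c))"
proof -
  have *: "blinfun_apply (\<mu> ((\<lambda>t. h (g t)) -` {v})) v =
      (\<Sum>c\<in>{c \<in> range g. h c = v}. blinfun_apply (\<mu> (g -` {c})) (h c))" for v
  proof -
    let ?C = "{c \<in> range g. h c = v}"
    have "(\<lambda>t. h (g t)) -` {v} = (\<Union>c\<in>?C. g -` {c})" by auto
    also have "\<mu> \<dots> = (\<Sum>c\<in>?C. \<mu> (g -` {c}))"
      using simple_function_borel_partition[OF g]
      by (intro finitely_additive_UN[OF \<mu>]) auto
    finally show ?thesis by (simp add: blinfun.sum_left)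
  qed
  have "simple_vint \<mu> (\<lambda>t. h (g t)) = (\<Sum>v\<in>h ` range g. blinfun_apply (\<mu> ((\<lambda>t. h (g t)) -` {v})) v)"
    by (simp add: simple_vint_def image_image)
  also have "\<dots> = (\<Sum>v\<in>h ` range g. \<Sum>c\<in>{c \<in> range g. h c = v}. blinfun_apply (\<mu> (g -` {c})) (h c))"
    by (simp add: *)
  also have "\<dots> = (\<Sum>c\<in>range g. blinfun_apply (\<mu> (g -` {c})) (h c))"
    by (rule sum.image_gen[symmetric, OF simple_function_borel_partition(1)[OF g]])
  finally show ?thesis .
qed

text \<open>The error of the integrand is at most \<open>e\<close> off \<open>D\<close> and
  \<open>c + e\<close> on \<open>D\<close>. Weighting it by the variation gives \<open>d * c\<close>
  from \<open>D\<close> and \<open>e * M\<close> from the whole space.\<close>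

lemma simple_vint_estimate:
  assumes \<mu>: "finitely_additive \<mu>" and s: "simple_function borel s"
    and A: "A \<in> sets borel" and D: "D \<in> sets borel"
    and bound: "\<And>t. norm (s t - indicator A t *\<^sub>R x) \<le> indicator D t * c + e"
    and var: "variation \<mu> D \<le> ennreal d" "variation \<mu> UNIV \<le> ennreal M"
    and nonneg: "0 \<le> c" "0 \<le> e" "0 \<le> d" "0 \<le> M"
  shows "\<bar>simple_vint \<mu> s - blinfun_apply (\<mu> A) x\<bar> \<le> d * c + e * M"
proof -
  \<comment> \<open>A common refinement: on each level set of \<open>g\<close> the value of
    \<open>s\<close> and membership in \<open>A\<close> and in \<open>D\<close> are
    constant.\<close>
  define g where "g t = (s t, t \<in> A, t \<in> D)" for t
  have g: "simple_function borel g"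
    unfolding g_def using s A D
    by (intro simple_function_Pair) (auto intro!: simple_function_Pair simp: simple_function_eq_measurable)
  note part = simple_function_borel_partition[OF g]
  have \<mu>A: "blinfun_apply (\<mu> A) x =
      (\<Sum>k\<in>range g. blinfun_apply (\<mu> (g -` {k})) (if fst (snd k) then x else 0))"
  proof -
    let ?C = "{k \<in> range g. fst (snd k)}"
    have eq: "(\<Union>k\<in>?C. g -` {k}) = A" by (auto simp: g_def)
    have "\<mu> (\<Union>k\<in>?C. g -` {k}) = (\<Sum>k\<in>?C. \<mu> (g -` {k}))"
      using part by (intro finitely_additive_UN[OF \<mu>]) auto
    then have "blinfun_apply (\<mu> A) x = (\<Sum>k\<in>?C. blinfun_apply (\<mu> (g -` {k})) x)"
      unfolding eq by (simp only: blinfun.sum_left)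
    also have "\<dots> = (\<Sum>k\<in>?C. blinfun_apply (\<mu> (g -` {k})) (if fst (snd k) then x else 0))"
      by (rule sum.cong) auto
    also have "\<dots> = (\<Sum>k\<in>range g. blinfun_apply (\<mu> (g -` {k})) (if fst (snd k) then x else 0))"
      using part(1) by (intro sum.mono_neutral_left) auto
    finally show ?thesis .
  qed
  have \<mu>s: "simple_vint \<mu> s = (\<Sum>k\<in>range g. blinfun_apply (\<mu> (g -` {k})) (fst k))"
    using simple_vint_comp[OF \<mu> g, of fst] by (simp add: g_def)
  have sum_le: "(\<Sum>k\<in>C. norm (\<mu> (g -` {k}))) \<le> b"
    if "C \<subseteq> range g" "(\<Union>k\<in>C. g -` {k}) \<subseteq> E" "E \<in> sets borel" "variation \<mu> E \<le> ennreal b" "0 \<le> b"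
    for C E b
  proof -
    have "(\<Sum>k\<in>C. ennreal (norm (\<mu> (g -` {k})))) \<le> variation \<mu> E"
      using that part finite_subset[OF that(1) part(1)]
      by (intro sum_norm_le_variation[OF \<mu>]) auto
    then have "ennreal (\<Sum>k\<in>C. norm (\<mu> (g -` {k}))) \<le> ennreal b"
      using that(4) by (simp add: sum_ennreal)
    then show ?thesis using that(5) by (simp add: ennreal_le_iff)
  qed
  have term_le: "norm (blinfun_apply (\<mu> (g -` {k})) (fst k - (if fst (snd k) then x else 0))) \<le>
      norm (\<mu> (g -` {k})) * (if snd (snd k) then c else 0) + norm (\<mu> (g -` {k})) * e"
    if "k \<in> range g" for k
  proof -
    obtain t where t: "k = g t" using \<open>k \<in> range g\<close> by blast
    have "norm (fst k - (if fst (snd k) then x else 0)) \<le> (if snd (snd k) then c else 0) + e"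
      using bound[of t] by (auto simp: t g_def split: if_splits)
    then have "norm (\<mu> (g -` {k})) * norm (fst k - (if fst (snd k) then x else 0)) \<le>
        norm (\<mu> (g -` {k})) * ((if snd (snd k) then c else 0) + e)"
      by (rule mult_left_mono) simp
    with norm_blinfun show ?thesis
      unfolding distrib_left by (rule order_trans)
  qed
  have "\<bar>simple_vint \<mu> s - blinfun_apply (\<mu> A) x\<bar> =
      norm (\<Sum>k\<in>range g. blinfun_apply (\<mu> (g -` {k})) (fst k - (if fst (snd k) then x else 0)))"
    by (simp only: \<mu>s \<mu>A real_norm_def blinfun.diff_right sum_subtractf)
  also have "\<dots> \<le> (\<Sum>k\<in>range g. norm (\<mu> (g -` {k})) * (if snd (snd k) then c else 0) + norm (\<mu> (g -` {k})) * e)"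
    by (rule sum_norm_le) (rule term_le)
  also have "\<dots> = (\<Sum>k\<in>range g. norm (\<mu> (g -` {k})) * (if snd (snd k) then c else 0)) +
      (\<Sum>k\<in>range g. norm (\<mu> (g -` {k}))) * e"
    by (simp add: sum.distrib sum_distrib_right)
  also have "(\<Sum>k\<in>range g. norm (\<mu> (g -` {k})) * (if snd (snd k) then c else 0)) =
      (\<Sum>k\<in>{k\<in>range g. snd (snd k)}. norm (\<mu> (g -` {k}))) * c"
    unfolding sum_distrib_right using part(1) by (intro sum.mono_neutral_cong_right) auto
  also have "\<dots> \<le> d * c"
    using var(1) D nonneg by (intro mult_right_mono sum_le[of _ D]) (auto simp: g_def)
  also have "(\<Sum>k\<in>range g. norm (\<mu> (g -` {k}))) * e \<le> M * e"
    using var(2) nonneg by (intro mult_right_mono sum_le[of _ UNIV]) auto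
  finally show ?thesis by (simp add: mult.commute)
qed

text \<open>Simple functions within \<open>e\<close> of \<open>F\<close> satisfy the bound up to
  \<open>e\<close>. As the total variation \<open>M\<close> is finite, this adds only
  \<open>e * M\<close>, which vanishes as \<open>e\<close> tends to zero.\<close>

lemma represents_functional_estimate:
  assumes rep: "represents_functional \<mu> \<phi>" and A: "A \<in> sets borel" and D: "D \<in> sets borel"
    and bound: "\<And>t. norm (apply_bcontfun F t - indicator A t *\<^sub>R x) \<le> indicator D t * c"
    and var: "variation \<mu> D \<le> ennreal d" and nonneg: "0 \<le> c" "0 \<le> d"
  shows "\<bar>blinfun_apply \<phi> F - blinfun_apply (\<mu> A) x\<bar> \<le> d * c"
proof -
  have \<mu>: "\<mu> \<in> rcabv" and int: "has_vint \<mu> (apply_bcontfun F) (blinfun_apply \<phi> F)"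
    using rep by (auto simp: represents_functional_def)
  note add = rcabv_finitely_additive[OF \<mu>]
  obtain M where M: "0 \<le> M" "variation \<mu> UNIV = ennreal M"
    using \<mu> unfolding rcabv_def by (cases "variation \<mu> UNIV") auto
  obtain s where s: "\<And>n. simple_function borel (s n)" "uniform_limit UNIV s (apply_bcontfun F) sequentially"
      "(\<lambda>n. simple_vint \<mu> (s n)) \<longlonglongrightarrow> blinfun_apply \<phi> F"
    using int by (auto simp: has_vint_def)
  have lim: "(\<lambda>n. \<bar>simple_vint \<mu> (s n) - blinfun_apply (\<mu> A) x\<bar>) \<longlonglongrightarrow>
      \<bar>blinfun_apply \<phi> F - blinfun_apply (\<mu> A) x\<bar>"
    by (intro tendsto_intros s(3))
  have "\<bar>blinfun_apply \<phi> F - blinfun_apply (\<mu> A) x\<bar> \<le> d * c + e * M" if "0 < e" for e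
  proof (rule tendsto_upperbound[OF lim])
    have "\<forall>\<^sub>F n in sequentially. \<forall>t\<in>UNIV. dist (s n t) (apply_bcontfun F t) < e"
      using uniform_limitD[OF s(2) that] .
    then show "\<forall>\<^sub>F n in sequentially. \<bar>simple_vint \<mu> (s n) - blinfun_apply (\<mu> A) x\<bar> \<le> d * c + e * M"
    proof eventually_elim
      case (elim n)
      have "norm (s n t - indicator A t *\<^sub>R x) \<le> indicator D t * c + e" for t
      proof -
        have "norm (s n t - indicator A t *\<^sub>R x) \<le>
            norm (s n t - apply_bcontfun F t) + norm (apply_bcontfun F t - indicator A t *\<^sub>R x)"
          using norm_triangle_ineq[of "s n t - apply_bcontfun F t" "apply_bcontfun F t - indicator A t *\<^sub>R x"]
          by simp
        moreover have "norm (s n t - apply_bcontfun F t) \<le> e"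
          using elim by (auto simp: dist_norm less_imp_le)
        ultimately show ?thesis using bound[of t] by linarith
      qed
      then show ?case
        using s(1) A D var M nonneg that by (intro simple_vint_estimate[OF add]) auto
    qed
  qed simp
  then have "(\<lambda>n. d * c + inverse (Suc n) * M) \<longlonglongrightarrow> d * c + 0 * M \<Longrightarrow> ?thesis"
    by (intro LIMSEQ_le_const) auto
  moreover have "(\<lambda>n. d * c + inverse (real (Suc n)) * M) \<longlonglongrightarrow> d * c + 0 * M"
    by (intro tendsto_intros LIMSEQ_inverse_real_of_nat)
  ultimately show ?thesis by blast
qed


subsection \<open>Approximation of the representing measure by multipliers\<close>

text \<open>Packaged as a family of sets so that it can serve as \<open>\<D>\<close> in
  \<open>uniformly_small_variation\<close>.\<close>

definition regularity_gaps :: "'k::t2_space set \<Rightarrow> 'k set set" where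
  "regularity_gaps A = {U - C | C U. compact C \<and> open U \<and> C \<subseteq> A \<and> A \<subseteq> U}"

lemma regularity_gaps_borel: "regularity_gaps A \<subseteq> sets borel"
  by (auto simp: regularity_gaps_def compact_imp_closed)

text \<open>\<open>(U - C) \<inter> (U' - C') = (U \<inter> U') - (C \<union> C')\<close>, where the
  new compact set still lies in \<open>A\<close> and the new open set still contains it.\<close>

lemma regularity_gaps_Int:
  assumes "D \<in> regularity_gaps A" "E \<in> regularity_gaps A"
  shows "D \<inter> E \<in> regularity_gaps A"
proof -
  obtain C U C' U' where "D = U - C" "compact C" "open U" "C \<subseteq> A" "A \<subseteq> U"
      "E = U' - C'" "compact C'" "open U'" "C' \<subseteq> A" "A \<subseteq> U'"
    using assms by (auto simp: regularity_gaps_def)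
  then show ?thesis
    unfolding regularity_gaps_def
    by (intro CollectI exI[of _ "C \<union> C'"] exI[of _ "U \<inter> U'"]) auto
qed

lemma rcabv_small_gap:
  fixes A :: "'k::t2_space set"
  assumes "\<mu> \<in> rcabv" "A \<in> sets borel" "0 < e"
  shows "\<exists>D\<in>regularity_gaps A. variation \<mu> D < ennreal e"
proof -
  obtain C U where "compact C" "open U" "C \<subseteq> A" "A \<subseteq> U" "variation \<mu> (U - C) < ennreal e"
    using assms unfolding rcabv_def by blast
  then show ?thesis by (intro bexI[of _ "U - C"]) (auto simp: regularity_gaps_def)
qed

text \<open>\<open>J\<close> multiplies by a Urysohn function. This function agrees with the
  indicator of \<open>A\<close> on \<open>C\<close> and off \<open>U\<close>; on
  \<open>U - C\<close> both lie between 0 and 1.\<close>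

lemma gap_multiplier:
  fixes A :: "'k::t2_space set"
  assumes K: "compact (UNIV :: 'k set)" and D: "D \<in> regularity_gaps A"
  obtains J :: "'x::real_normed_vector \<Rightarrow>\<^sub>L ('k \<Rightarrow>\<^sub>C 'x)"
  where "\<And>x t. norm (apply_bcontfun (blinfun_apply J x) t - indicator A t *\<^sub>R x) \<le> indicator D t * norm x"
proof -
  obtain C U where CU: "D = U - C" "compact C" "open U" "C \<subseteq> A" "A \<subseteq> U"
    using D by (auto simp: regularity_gaps_def)
  have "Hausdorff_space (euclidean :: 'k topology)"
    by (simp add: Hausdorff_space_def disjnt_def) (metis separation_t2)
  then have "normal_space (euclidean :: 'k topology)"
    using K by (intro compact_Hausdorff_or_regular_imp_normal_space) (auto simp: compact_space_def)
  moreover have "closedin euclidean (- U)" "closedin euclidean C" "disjnt (- U) C"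
    using CU compact_imp_closed by (auto simp: disjnt_def)
  ultimately obtain f where "continuous_map euclidean (top_of_set {0..1::real}) f"
      and f: "f ` (- U) \<subseteq> {0}" "f ` C \<subseteq> {1}"
    by (rule Urysohn_lemma[where a = 0 and b = 1]) auto
  then have cont: "continuous_on UNIV f" and f01: "\<And>t. 0 \<le> f t \<and> f t \<le> 1"
    by (auto simp: continuous_map_in_subtopology)
  have bc: "(\<lambda>t. f t *\<^sub>R x) \<in> bcontfun" for x :: 'x
    using f01 by (intro bcontfun_normI[where b = "norm x"] continuous_intros cont)
      (auto intro: mult_left_le_one_le)
  define j where "j x = Bcontfun (\<lambda>t. f t *\<^sub>R x)" for x :: 'x
  have j: "apply_bcontfun (j x) t = f t *\<^sub>R x" for x t
    unfolding j_def by (simp add: Bcontfun_inverse[OF bc])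
  have bl: "bounded_linear j"
  proof (rule bounded_linear_intro[where K = 1])
    show "j (x + y) = j x + j y" for x y
      by (rule bcontfun_eqI) (simp add: j algebra_simps)
    show "j (r *\<^sub>R x) = r *\<^sub>R j x" for r x
      by (rule bcontfun_eqI) (simp add: j algebra_simps)
    show "norm (j x) \<le> norm x * 1" for x
      using f01 by (intro norm_bound) (auto simp: j intro: mult_left_le_one_le)
  qed
  have "norm (apply_bcontfun (j x) t - indicator A t *\<^sub>R x) \<le> indicator D t * norm x" for x t
  proof -
    have "norm (apply_bcontfun (j x) t - indicator A t *\<^sub>R x) = \<bar>f t - indicator A t\<bar> * norm x"
      by (simp add: j flip: scaleR_diff_left)
    also have "\<bar>f t - indicator A t\<bar> \<le> (indicator D t :: real)"
      using f f01[of t] CU by (auto simp: indicator_def split: if_splits)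
    finally show ?thesis by (simp add: mult_right_mono)
  qed
  then show thesis
    by (intro that[of "Blinfun j"]) (simp add: bounded_linear_Blinfun_apply[OF bl])
qed

text \<open>On a gap that is small for both measures, one multiplier \<open>J\<close> brings
  \<open>\<phi> (J x)\<close> within \<open>e / 2 * norm x\<close> of both values at
  \<open>A\<close>.\<close>

lemma represents_functional_unique:
  fixes A :: "'k::t2_space set" and \<phi> :: "('k \<Rightarrow>\<^sub>C 'x::real_normed_vector) dual"
  assumes K: "compact (UNIV :: 'k set)" and A: "A \<in> sets borel"
    and \<mu>: "represents_functional \<mu> \<phi>" and \<nu>: "represents_functional \<nu> \<phi>"
  shows "\<mu> A = \<nu> A"
proof -
  \<comment> \<open>The summand 0 gives the shape that \<open>field_le_epsilon\<close>
    expects.\<close>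
  have "norm (\<mu> A - \<nu> A) \<le> 0 + e" if "0 < e" for e :: real
  proof -
    have rc: "\<mu> \<in> rcabv" "\<nu> \<in> rcabv"
      using \<mu> \<nu> by (auto simp: represents_functional_def)
    obtain D E where DE: "D \<in> regularity_gaps A" "variation \<mu> D < ennreal (e / 2)"
        "E \<in> regularity_gaps A" "variation \<nu> E < ennreal (e / 2)"
      using rcabv_small_gap[OF rc(1) A, of "e / 2"] rcabv_small_gap[OF rc(2) A, of "e / 2"] \<open>0 < e\<close>
      by auto
    define G where "G = D \<inter> E"
    have G: "G \<in> regularity_gaps A" "G \<in> sets borel" "D \<in> sets borel" "E \<in> sets borel"
      using regularity_gaps_Int[OF DE(1,3)] regularity_gaps_borel[of A] DE by (auto simp: G_def)
    have var: "variation \<mu> G \<le> ennreal (e / 2)" "variation \<nu> G \<le> ennreal (e / 2)"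
      using DE variation_mono[OF rcabv_finitely_additive[OF rc(1)], of G D]
        variation_mono[OF rcabv_finitely_additive[OF rc(2)], of G E] G
      by (auto simp: G_def intro: order_trans)
    obtain J :: "'x \<Rightarrow>\<^sub>L ('k \<Rightarrow>\<^sub>C 'x)" where
      J: "\<And>x t. norm (apply_bcontfun (blinfun_apply J x) t - indicator A t *\<^sub>R x) \<le> indicator G t * norm x"
      using gap_multiplier[OF K G(1)] by blast
    show ?thesis
    proof (rule norm_blinfun_bound)
      fix x
      have "\<bar>blinfun_apply \<phi> (J x) - blinfun_apply (\<mu> A) x\<bar> \<le> e / 2 * norm x"
        using \<open>0 < e\<close> by (intro represents_functional_estimate[OF \<mu> A G(2) J var(1)]) auto
      moreover have "\<bar>blinfun_apply \<phi> (J x) - blinfun_apply (\<nu> A) x\<bar> \<le> e / 2 * norm x"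
        using \<open>0 < e\<close> by (intro represents_functional_estimate[OF \<nu> A G(2) J var(2)]) auto
      moreover have "e / 2 * norm x + e / 2 * norm x = (0 + e) * norm x"
        by simp
      ultimately show "norm (blinfun_apply (\<mu> A - \<nu> A) x) \<le> (0 + e) * norm x"
        unfolding blinfun.diff_left real_norm_def by linarith
    qed (use \<open>0 < e\<close> in simp)
  qed
  then have "norm (\<mu> A - \<nu> A) \<le> 0" by (rule field_le_epsilon)
  then show ?thesis by simp
qed

text \<open>In \<open>is_chi\<close> the measure is chosen separately for each set and vector;
  uniqueness merges these choices into a single regular measure that represents
  \<open>\<psi> o\<^sub>L T\<close>.\<close>

lemma representing_measure_dual_measure:
  fixes T :: "('k::t2_space \<Rightarrow>\<^sub>C 'x::real_normed_vector) \<Rightarrow>\<^sub>L 'y::real_normed_vector"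
  assumes K: "compact (UNIV :: 'k set)" and m: "representing_measure m T"
  obtains \<mu> where "represents_functional \<mu> (\<psi> o\<^sub>L T)" "\<And>A. A \<in> sets borel \<Longrightarrow> dual_measure \<psi> m A = \<mu> A"
proof -
  have ex: "\<exists>\<mu>. represents_functional \<mu> (\<psi> o\<^sub>L T) \<and> blinfun_apply (m A) x \<psi> = blinfun_apply (\<mu> A) x"
    if A: "A \<in> sets borel" for A x
  proof -
    obtain \<Phi> where "is_chi A x \<Phi>" "blinfun_apply (m A) x = blinfun_apply (dual_op (dual_op T)) \<Phi>"
      using m A unfolding representing_measure_def by blast
    then show ?thesis by (auto simp: is_chi_def)
  qed
  \<comment> \<open>The empty set and the zero vector are arbitrary choices here; only the existence
    of a representing measure is extracted.\<close>
  obtain \<mu> where \<mu>: "represents_functional \<mu> (\<psi> o\<^sub>L T)" using ex[of "{}" 0] by auto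
  moreover have "dual_measure \<psi> m A = \<mu> A" if A: "A \<in> sets borel" for A
  proof (rule blinfun_eqI)
    fix x
    obtain \<nu> where \<nu>: "represents_functional \<nu> (\<psi> o\<^sub>L T)" "blinfun_apply (m A) x \<psi> = blinfun_apply (\<nu> A) x"
      using ex[OF A] by blast
    then show "blinfun_apply (dual_measure \<psi> m A) x = blinfun_apply (\<mu> A) x"
      using represents_functional_unique[OF K A \<nu>(1) \<mu>] by (simp add: dual_measure_apply)
  qed
  ultimately show thesis using that by blast
qed

text \<open>Strong boundedness is the continuity hypothesis of
  \<open>uniformly_small_variation\<close> for the measures indexed by the dual unit ball. One gap
  is thus small for all of them, and its multiplier approximates \<open>m A\<close>
  uniformly.\<close>

lemma strongly_bounded_approximation:
  fixes T :: "('k::t2_space \<Rightarrow>\<^sub>C 'x::real_normed_vector) \<Rightarrow>\<^sub>L 'y::real_normed_vector"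
  assumes K: "compact (UNIV :: 'k set)" and m: "representing_measure m T" and sb: "strongly_bounded m"
    and A: "A \<in> sets borel" and e: "0 < e"
  obtains J :: "'x \<Rightarrow>\<^sub>L ('k \<Rightarrow>\<^sub>C 'x)"
  where "\<And>x. norm (canon (blinfun_apply T (blinfun_apply J x)) - blinfun_apply (m A) x) \<le> e * norm x"
proof -
  let ?B = "{\<psi> :: 'y dual. norm \<psi> \<le> 1}"
  let ?P = "\<lambda>\<psi> \<mu>. represents_functional \<mu> (\<psi> o\<^sub>L T) \<and> (\<forall>A\<in>sets borel. dual_measure \<psi> m A = \<mu> A)"
  have "\<exists>\<mu>. ?P \<psi> \<mu>" for \<psi>
    by (rule representing_measure_dual_measure[OF K m, of \<psi>]) blast
  then obtain \<mu> where \<mu>: "\<And>\<psi>. ?P \<psi> (\<mu> \<psi>)"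
    using choice[of ?P] by blast
  then have rep: "represents_functional (\<mu> \<psi>) (\<psi> o\<^sub>L T)"
      and dm: "\<And>A. A \<in> sets borel \<Longrightarrow> dual_measure \<psi> m A = \<mu> \<psi> A" for \<psi>
    by auto
  have rc: "\<mu> \<psi> \<in> rcabv" for \<psi> using rep by (auto simp: represents_functional_def)
  have semi: "semivariation m E = (SUP \<psi>\<in>?B. variation (\<mu> \<psi>) E)" for E
    unfolding semivariation_def using variation_cong[OF dm] by (intro SUP_cong) auto
  \<comment> \<open>The trivial gap, from the empty compact set and the whole space, shows that the
    family is nonempty.\<close>
  have "UNIV - {} \<in> regularity_gaps A"
    unfolding regularity_gaps_def by (intro CollectI exI[of _ "{}"] exI[of _ UNIV]) auto
  then have ne: "regularity_gaps A \<noteq> {}" by blast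
  have "\<exists>D\<in>regularity_gaps A. \<forall>\<psi>\<in>?B. variation (\<mu> \<psi>) D \<le> ennreal e"
  proof (rule uniformly_small_variation[where \<nu> = \<mu> and I = ?B and \<D> = "regularity_gaps A"])
    fix B :: "nat \<Rightarrow> 'k set"
    assume "range B \<subseteq> sets borel" "decseq B" "(\<Inter>n. B n) = {}"
    then show "(\<lambda>n. SUP \<psi>\<in>?B. variation (\<mu> \<psi>) (B n)) \<longlonglongrightarrow> 0"
      using sb unfolding strongly_bounded_def semi by blast
  qed (use ne e in \<open>auto intro: rcabv_finitely_additive rc regularity_gaps_Int rcabv_small_gap A
      subsetD[OF regularity_gaps_borel]\<close>)
  then obtain D where D: "D \<in> regularity_gaps A" "\<And>\<psi>. norm \<psi> \<le> 1 \<Longrightarrow> variation (\<mu> \<psi>) D \<le> ennreal e"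
    by auto
  have D_borel: "D \<in> sets borel" using D(1) regularity_gaps_borel by blast
  obtain J :: "'x \<Rightarrow>\<^sub>L ('k \<Rightarrow>\<^sub>C 'x)" where
    J: "\<And>x t. norm (apply_bcontfun (blinfun_apply J x) t - indicator A t *\<^sub>R x) \<le> indicator D t * norm x"
    using gap_multiplier[OF K D(1)] by blast
  have unit: "\<bar>blinfun_apply (canon (T (J x)) - m A x) \<psi>\<bar> \<le> e * norm x" if "norm \<psi> \<le> 1" for \<psi> x
  proof -
    have "\<bar>blinfun_apply (\<psi> o\<^sub>L T) (J x) - blinfun_apply (\<mu> \<psi> A) x\<bar> \<le> e * norm x"
      using e by (intro represents_functional_estimate[OF rep A D_borel J D(2)[OF that]]) auto
    then show ?thesis
      using dm[OF A, of \<psi>] by (simp add: blinfun.diff_left flip: dual_measure_apply)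
  qed
  have "norm (canon (T (J x)) - m A x) \<le> e * norm x" for x
  proof (rule norm_blinfun_bound)
    fix \<psi> :: "'y dual"
    show "norm (blinfun_apply (canon (T (J x)) - m A x) \<psi>) \<le> e * norm x * norm \<psi>"
    proof (cases "\<psi> = 0")
      case False
      \<comment> \<open>The bound on the unit ball extends to all functionals by
        homogeneity.\<close>
      then show ?thesis
        using unit[of "inverse (norm \<psi>) *\<^sub>R \<psi>" x]
        by (simp add: blinfun.scaleR_right abs_mult field_simps)
    qed simp
  qed (use e in simp)
  then show thesis by (rule that)
qed

text \<open>Approximants of \<open>m A\<close> in the bidual come from operators into
  \<open>Y\<close> and, the embedding being isometric, form a Cauchy sequence there. Completeness of
  \<open>Y\<close> supplies the limit \<open>S\<close>.\<close>

lemma strongly_bounded_corestriction: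
  fixes T :: "('k::t2_space \<Rightarrow>\<^sub>C 'x::real_normed_vector) \<Rightarrow>\<^sub>L 'y::banach"
  assumes K: "compact (UNIV :: 'k set)" and m: "representing_measure m T" and sb: "strongly_bounded m"
    and A: "A \<in> sets borel"
  obtains S :: "'x \<Rightarrow>\<^sub>L 'y" and J :: "nat \<Rightarrow> 'x \<Rightarrow>\<^sub>L ('k \<Rightarrow>\<^sub>C 'x)"
  where "is_corestriction S (m A)" "(\<lambda>n. T o\<^sub>L J n) \<longlonglongrightarrow> S"
proof -
  have "\<exists>J :: 'x \<Rightarrow>\<^sub>L ('k \<Rightarrow>\<^sub>C 'x). \<forall>x. norm (canon (T (J x)) - m A x) \<le> inverse (real (Suc n)) * norm x" for n
    by (rule strongly_bounded_approximation[OF K m sb A, of "inverse (real (Suc n))"]) auto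
  then obtain J :: "nat \<Rightarrow> 'x \<Rightarrow>\<^sub>L ('k \<Rightarrow>\<^sub>C 'x)"
    where J: "\<And>n x. norm (canon (T (J n x)) - m A x) \<le> inverse (real (Suc n)) * norm x"
    by metis
  let ?R = "\<lambda>n. T o\<^sub>L J n"
  have dist_le: "norm (?R n - ?R k) \<le> inverse (real (Suc n)) + inverse (real (Suc k))" for n k
  proof (rule norm_blinfun_bound)
    fix x
    \<comment> \<open>Passing to the bidual allows \<open>m A x\<close> to be inserted between the
      two approximants.\<close>
    have "norm (blinfun_apply (?R n - ?R k) x) =
        norm ((canon (T (J n x)) - m A x) - (canon (T (J k x)) - m A x))"
      by (simp add: blinfun.diff_left flip: canon_diff)
    also have "\<dots> \<le> inverse (real (Suc n)) * norm x + inverse (real (Suc k)) * norm x"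
      by (intro norm_triangle_le_diff add_mono J)
    finally show "norm (blinfun_apply (?R n - ?R k) x) \<le> (inverse (real (Suc n)) + inverse (real (Suc k))) * norm x"
      by (simp add: algebra_simps)
  qed simp
  have "Cauchy ?R"
  proof (rule CauchyI)
    fix e :: real assume "0 < e"
    then obtain N where N: "inverse (real (Suc N)) < e / 2"
      using reals_Archimedean[of "e / 2"] by auto
    have "norm (?R n - ?R k) < e" if "N \<le> n" "N \<le> k" for n k
    proof -
      have "inverse (real (Suc n)) \<le> inverse (real (Suc N))" "inverse (real (Suc k)) \<le> inverse (real (Suc N))"
        using that by auto
      with dist_le[of n k] N show ?thesis by linarith
    qed
    then show "\<exists>M. \<forall>n\<ge>M. \<forall>k\<ge>M. norm (?R n - ?R k) < e" by blast
  qed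
  then obtain S where S: "?R \<longlonglongrightarrow> S"
    by (auto simp: Cauchy_convergent_iff convergent_def)
  \<comment> \<open>Both sides are limits of \<open>canon (?R n x)\<close>.\<close>
  have "canon (S x) = m A x" for x
  proof (rule LIMSEQ_unique)
    have "(\<lambda>n. ?R n x) \<longlonglongrightarrow> S x"
      by (intro tendsto_intros S)
    then have "(\<lambda>n. norm (canon (?R n x) - canon (S x))) \<longlonglongrightarrow> 0"
      by (simp add: tendsto_norm_zero_iff LIM_zero_iff flip: canon_diff)
    then show "(\<lambda>n. canon (?R n x)) \<longlonglongrightarrow> canon (S x)"
      by (simp add: tendsto_norm_zero_iff LIM_zero_iff)
    have "(\<lambda>n. inverse (real (Suc n)) * norm x) \<longlonglongrightarrow> 0 * norm x"
      by (intro tendsto_intros LIMSEQ_inverse_real_of_nat)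
    then have "(\<lambda>n. inverse (real (Suc n)) * norm x) \<longlonglongrightarrow> 0"
      by (simp only: mult_zero_left)
    moreover have "\<forall>\<^sub>F n in sequentially. norm (canon (?R n x) - m A x) \<le> inverse (real (Suc n)) * norm x"
      unfolding blinfun_apply_blinfun_compose by (rule always_eventually) (rule allI, rule J)
    ultimately have "(\<lambda>n. canon (?R n x) - m A x) \<longlonglongrightarrow> 0"
      by (rule Lim_null_comparison[rotated])
    then show "(\<lambda>n. canon (?R n x)) \<longlonglongrightarrow> m A x"
      by (simp add: LIM_zero_iff)
  qed
  then have "is_corestriction S (m A)" by (simp add: is_corestriction_def)
  then show thesis using S that by blast
qed

section \<open>Stability under composition and under operator-norm limits\<close>

lemma limited_image:
  fixes J :: "'a::real_normed_vector \<Rightarrow>\<^sub>L 'b::real_normed_vector"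
  assumes "limited A"
  shows "limited (blinfun_apply J ` A)"
  unfolding limited_def
proof (intro conjI allI impI)
  show "bounded (J ` A)"
    using assms by (intro bounded_linear_image blinfun.bounded_linear_right) (simp add: limited_def)
  fix \<phi> :: "nat \<Rightarrow> 'b dual"
  assume "\<forall>y. (\<lambda>n. blinfun_apply (\<phi> n) y) \<longlonglongrightarrow> 0"
  \<comment> \<open>A weak-star null sequence pulled back along \<open>J\<close> is weak-star null,
    so limitedness of \<open>A\<close> applies to it.\<close>
  then have "\<forall>x. (\<lambda>n. blinfun_apply (\<phi> n o\<^sub>L J) x) \<longlonglongrightarrow> 0"
    by simp
  with assms have "(\<lambda>n. SUP x\<in>A. ennreal \<bar>blinfun_apply (\<phi> n o\<^sub>L J) x\<bar>) \<longlonglongrightarrow> 0"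
    unfolding limited_def by (elim conjE allE[of _ "\<lambda>n. \<phi> n o\<^sub>L J"]) (rule mp)
  then show "(\<lambda>n. SUP y\<in>J ` A. ennreal \<bar>blinfun_apply (\<phi> n) y\<bar>) \<longlonglongrightarrow> 0"
    by (simp add: image_image)
qed

lemma weakly_null_image:
  assumes "weakly_null x"
  shows "weakly_null (\<lambda>n. blinfun_apply J (x n))"
  unfolding weakly_null_def
proof
  fix \<phi> :: "'b dual"
  show "(\<lambda>n. blinfun_apply \<phi> (J (x n))) \<longlonglongrightarrow> 0"
    using assms[unfolded weakly_null_def, rule_format, of "\<phi> o\<^sub>L J"] by simp
qed

lemma weakly_p_summable_image:
  assumes "weakly_p_summable p x"
  shows "weakly_p_summable p (\<lambda>n. blinfun_apply J (x n))"
  unfolding weakly_p_summable_def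
proof
  fix \<phi> :: "'b dual"
  show "summable (\<lambda>n. \<bar>blinfun_apply \<phi> (J (x n))\<bar> powr p)"
    using assms[unfolded weakly_p_summable_def, rule_format, of "\<phi> o\<^sub>L J"] by simp
qed

lemma limited_range_image:
  "limited (range x) \<Longrightarrow> limited (range (\<lambda>n. blinfun_apply J (x n)))"
  using limited_image[of "range x" J] by (simp add: image_image)

text \<open>Boundedness of the sequence makes the error of replacing \<open>S\<close> by one fixed
  \<open>R n\<close> uniform in \<open>k\<close>; the choice \<open>e / (2 * M)\<close> keeps it
  below half of \<open>e\<close>.\<close>

lemma tendsto_zero_operator_limit:
  assumes R: "R \<longlonglongrightarrow> S" and x: "bounded (range x)"
    and null: "\<And>n. (\<lambda>k. blinfun_apply (R n) (x k)) \<longlonglongrightarrow> 0"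
  shows "(\<lambda>k. blinfun_apply S (x k)) \<longlonglongrightarrow> 0"
proof (rule LIMSEQ_I)
  fix e :: real assume e: "0 < e"
  obtain M where M: "0 < M" "\<And>k. norm (x k) \<le> M"
    using x by (auto simp: bounded_pos)
  obtain n where n: "norm (R n - S) < e / (2 * M)"
    using LIMSEQ_D[OF R, of "e / (2 * M)"] e M by auto
  obtain N where N: "\<And>k. N \<le> k \<Longrightarrow> norm (R n (x k)) < e / 2"
    using LIMSEQ_D[OF null[of n], of "e / 2"] e by auto
  have "norm (S (x k) - 0) < e" if "N \<le> k" for k
  proof -
    have "norm ((R n - S) (x k)) \<le> norm (R n - S) * norm (x k)"
      by (rule norm_blinfun)
    also have "\<dots> \<le> e / (2 * M) * M"
      using n M e by (intro mult_mono) auto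
    also have "\<dots> = e / 2" using M by simp
    finally have "norm (R n (x k) - S (x k)) \<le> e / 2"
      by (simp add: blinfun.diff_left)
    then show ?thesis
      using N[OF that] norm_triangle_ineq4[of "R n (x k)" "R n (x k) - S (x k)"] by simp
  qed
  then show "\<exists>N. \<forall>k\<ge>N. norm (S (x k) - 0) < e" by blast
qed

theorem theorem20:
  fixes p :: real
    and T :: "('k::t2_space \<Rightarrow>\<^sub>C 'x::banach) \<Rightarrow>\<^sub>L 'y::banach"
    and m :: "'k set \<Rightarrow> 'x \<Rightarrow>\<^sub>L 'y dual dual"
  assumes "1 \<le> p"
    and "compact (UNIV :: 'k set)"
    and "representing_measure m T"
    and "strongly_bounded m"
  shows "(limited_completely_continuous T \<longrightarrow>
           (\<forall>A\<in>sets borel. \<exists>S :: 'x \<Rightarrow>\<^sub>L 'y.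
              is_corestriction S (m A) \<and> limited_completely_continuous S)) \<and>
         (limited_p_convergent p T \<longrightarrow>
           (\<forall>A\<in>sets borel. \<exists>S :: 'x \<Rightarrow>\<^sub>L 'y.
              is_corestriction S (m A) \<and> limited_p_convergent p S))"
proof (intro conjI impI ballI)
  fix A :: "'k set" assume A: "A \<in> sets borel"
  obtain S :: "'x \<Rightarrow>\<^sub>L 'y" and J :: "nat \<Rightarrow> 'x \<Rightarrow>\<^sub>L ('k \<Rightarrow>\<^sub>C 'x)"
    where S: "is_corestriction S (m A)" "(\<lambda>n. T o\<^sub>L J n) \<longlonglongrightarrow> S"
    by (rule strongly_bounded_corestriction[OF assms(2-4) A])
  \<comment> \<open>Shared by both claims: limited sequences are bounded, so it suffices that each
    \<open>T o\<^sub>L J n\<close> sends the sequence to a null sequence. This holds since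
    \<open>J n\<close> preserves the class of sequences on which \<open>T\<close> is tested.\<close>
  have null: "(\<lambda>k. S (x k)) \<longlonglongrightarrow> 0"
    if "limited (range x)" "\<And>n. (\<lambda>k. T (J n (x k))) \<longlonglongrightarrow> 0" for x
    by (rule tendsto_zero_operator_limit[OF S(2)]) (use that in \<open>auto simp: limited_def\<close>)
  show "\<exists>S :: 'x \<Rightarrow>\<^sub>L 'y. is_corestriction S (m A) \<and> limited_completely_continuous S"
    if "limited_completely_continuous T"
    using that S(1) unfolding limited_completely_continuous_def
    by (blast intro: null weakly_null_image limited_range_image)
  show "\<exists>S :: 'x \<Rightarrow>\<^sub>L 'y. is_corestriction S (m A) \<and> limited_p_convergent p S"
    if "limited_p_convergent p T"
    using that S(1) unfolding limited_p_convergent_def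
    by (blast intro: null weakly_p_summable_image limited_range_image)
qed

end
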